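(* Let $\mathcal{A}$ be an $m$-order $n$-dimensional $M$-tensor, and denote by $\tau(\mathcal{A})$ the minimal value of the real part of all eigenvalues of $\mathcal{A}$. Then $\tau(\mathcal{A})>0$, and $\tau(\mathcal{A})$ is an eigenvalue of $\mathcal{A}$ with a nonnegative eigenvector. Moreover, there exist a nonnegative $m$-order $n$-dimensional tensor $\mathcal{B}$ and a real number $c>\rho(\mathcal{B})$ such that $\tau(\mathcal{A})=c-\rho(\mathcal{B})$. If $\mathcal{A}$ is irreducible, then $\tau(\mathcal{A})$ is the unique eigenvalue of $\mathcal{A}$ with a positive eigenvector.
   Context: Let $m\ge 2$ and $n\ge 1$ be integers. An $m$-order $n$-dimensional (square real) tensor is an array $\mathcal{A}=(A_{i_1\cdots i_m})$ with $A_{i_1\cdots i_m}\in\mathbb{R}$, $1\le i_1,\dots,i_m\le n$. It is nonnegative if all its entries are $\ge 0$. The unit tensor $\mathcal{I}$ has entries $\delta_{i_1\ldots i_m}=1$ if $i_1=\cdots=i_m$ and $0$ otherwise. For $x\in\mathbb{C}^n$, $\mathcal{A}x^{m-1}\in\mathbb{C}^n$ has $i$-th component $\sum_{i_2,\ldots,i_m=1}^n A_{ii_2\cdots i_m}x_{i_2}\cdots x_{i_m}$, and $x^{[m-1]}=(x_i^{m-1})_{1\le i\le n}$. A number $\lambda\in\mathbb{C}$ is an eigenvalue of $\mathcal{A}$ with eigenvector $x\in\mathbb{C}^n\setminus\{0\}$ if $\mathcal{A}x^{m-1}=\lambda x^{[m-1]}$. An eigenvector is nonnegative (positive) if all its components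 are real and $\ge 0$ ($>0$). The spectral radius is $\rho(\mathcal{A})=\max\{|\lambda| : \lambda \text{ is an eigenvalue of } \mathcal{A}\}$. $\mathcal{A}$ is an $M$-tensor if there exist a nonnegative tensor $\mathcal{B}$ (of the same order and dimension) and a real number $c>\rho(\mathcal{B})$ such that $\mathcal{A}=c\mathcal{I}-\mathcal{B}$. $\mathcal{A}$ is reducible if there is a nonempty proper subset $I\subset\{1,\ldots,n\}$ such that $A_{i_1\cdots i_m}=0$ for all $i_1\in I$ and all $i_2,\ldots,i_m\notin I$; otherwise $\mathcal{A}$ is irreducible. *)

theory Defs
  imports "HOL-Analysis.Analysis"
begin

text \<open>
  A tensor of order \<open>m\<close> and dimension \<open>n = CARD('n)\<close> is a real function on index lists; only its
  values on lists \<open>[i\<^sub>1, \<dots>, i\<^sub>m]\<close> of length \<open>m\<close> are entries, and every notion below ignores the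
  other values. Hence equality of tensors is equality on the lists of length \<open>m\<close>.
\<close>

type_synonym 'n tensor = "'n list \<Rightarrow> real"

definition tensor_nonneg :: "nat \<Rightarrow> 'n tensor \<Rightarrow> bool" where
  "tensor_nonneg m A \<longleftrightarrow> (\<forall>js. length js = m \<longrightarrow> 0 \<le> A js)"

definition unit_tensor :: "'n tensor" where
  "unit_tensor js = (if \<forall>i\<in>set js. \<forall>j\<in>set js. i = j then 1 else 0)"

text \<open>The vector \<open>A x\<^bsup>m-1\<^esup>\<close>.\<close>

definition tensor_apply :: "nat \<Rightarrow> 'n::finite tensor \<Rightarrow> complex ^ 'n \<Rightarrow> complex ^ 'n" where
  "tensor_apply m A x =
     (\<chi> i. \<Sum>js\<in>{js. length js = m - 1}. of_real (A (i # js)) * (\<Prod>j\<leftarrow>js. x $ j))"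

definition tensor_eigenpair :: "nat \<Rightarrow> 'n::finite tensor \<Rightarrow> complex \<Rightarrow> complex ^ 'n \<Rightarrow> bool" where
  "tensor_eigenpair m A l x \<longleftrightarrow> x \<noteq> 0 \<and> tensor_apply m A x = (\<chi> i. l * (x $ i) ^ (m - 1))"

definition tensor_eigenvalue :: "nat \<Rightarrow> 'n::finite tensor \<Rightarrow> complex \<Rightarrow> bool" where
  "tensor_eigenvalue m A l \<longleftrightarrow> (\<exists>x. tensor_eigenpair m A l x)"

definition nonneg_vec :: "complex ^ 'n \<Rightarrow> bool" where
  "nonneg_vec x \<longleftrightarrow> (\<forall>i. x $ i \<in> \<real> \<and> 0 \<le> Re (x $ i))"

definition pos_vec :: "complex ^ 'n \<Rightarrow> bool" where
  "pos_vec x \<longleftrightarrow> (\<forall>i. x $ i \<in> \<real> \<and> 0 < Re (x $ i))"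

text \<open>
  \<open>GREATEST\<close> and \<open>LEAST\<close> denote the maximum and minimum of a set of reals without presupposing
  that the set is finite, as \<open>Max\<close> and \<open>Min\<close> do; unlike \<open>Sup\<close> and \<open>Inf\<close> they say nothing unless
  the extremum is attained.
\<close>

definition tensor_spectral_radius :: "nat \<Rightarrow> 'n::finite tensor \<Rightarrow> real" where
  "tensor_spectral_radius m A = (GREATEST r. \<exists>l. tensor_eigenvalue m A l \<and> r = cmod l)"

definition tensor_tau :: "nat \<Rightarrow> 'n::finite tensor \<Rightarrow> real" where
  "tensor_tau m A = (LEAST r. \<exists>l. tensor_eigenvalue m A l \<and> r = Re l)"

definition M_tensor :: "nat \<Rightarrow> 'n::finite tensor \<Rightarrow> bool" where
  "M_tensor m A \<longleftrightarrow>
     (\<exists>(B :: 'n tensor) (c :: real). tensor_nonneg m B \<and> tensor_spectral_radius m B < c \<and>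
        (\<forall>js. length js = m \<longrightarrow> A js = c * unit_tensor js - B js))"

definition tensor_reducible :: "nat \<Rightarrow> 'n tensor \<Rightarrow> bool" where
  "tensor_reducible m A \<longleftrightarrow>
     (\<exists>I. I \<noteq> {} \<and> I \<noteq> UNIV \<and>
        (\<forall>i js. i \<in> I \<and> length js = m - 1 \<and> set js \<inter> I = {} \<longrightarrow> A (i # js) = 0))"

end

theory Submission
  imports Defs
begin

text \<open>
  Write \<open>F(x) = B x\<^bsup>m-1\<^esup>\<close> for a nonnegative tensor \<open>B\<close>. For \<open>e > 0\<close>, Brouwer's theorem applied to the
  normalised \<open>(m-1)\<close>-th root of \<open>F(x) + e\<close> on the standard simplex gives a positive \<open>x\<close> with
  \<open>F(x) + e = r x\<^bsup>[m-1]\<^esup>\<close>. Comparing an arbitrary eigenvector \<open>z\<close> with the smallest multiple of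
  \<open>x\<close> that dominates \<open>|z|\<close> shows \<open>|l| \<le> r\<close> for each eigenvalue \<open>l\<close> of \<open>B\<close>. Letting \<open>e\<close> tend to \<open>0\<close>,
  compactness yields an eigenvalue with a nonnegative eigenvector that dominates all eigenvalues in
  modulus; it is the spectral radius. The eigenvalues of \<open>c I - B\<close> are the numbers \<open>c - l\<close>, so
  the one with the least real part is \<open>c\<close> minus the spectral radius of \<open>B\<close>. The same
  comparison, with a positive eigenvector of \<open>B\<close> for \<open>x\<close>, gives uniqueness.
\<close>

section \<open>The tensor action on real vectors\<close>

text \<open>Monotonicity, Brouwer's theorem and the compactness argument are used over the reals;
  \<open>vec_of_real\<close> carries their outcome back to complex eigenpairs.\<close>

definition real_apply :: "nat \<Rightarrow> 'n::finite tensor \<Rightarrow> real ^ 'n \<Rightarrow> real ^ 'n" where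
  "real_apply m B x = (\<chi> i. \<Sum>js\<in>{js. length js = m - 1}. B (i # js) * (\<Prod>j\<leftarrow>js. x $ j))"

definition vec_of_real :: "real ^ 'n \<Rightarrow> complex ^ 'n" where
  "vec_of_real x = (\<chi> i. of_real (x $ i))"

lemma finite_lists_length: "finite {js :: 'n::finite list. length js = k}"
  using finite_lists_length_eq[of "UNIV :: 'n set" k] by simp

lemma of_real_prod_list:
  "of_real (\<Prod>j\<leftarrow>js. f j) = (\<Prod>j\<leftarrow>js. of_real (f j) :: 'a::{real_algebra_1,comm_ring_1})"
  by (induction js) auto

lemma norm_prod_list:
  "norm (\<Prod>j\<leftarrow>js. f j) = (\<Prod>j\<leftarrow>js. norm (f j :: 'a::real_normed_div_algebra))"
  by (induction js) (auto simp: norm_mult)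

lemma prod_list_nonneg:
  "(\<And>j. j \<in> set js \<Longrightarrow> 0 \<le> f j) \<Longrightarrow> 0 \<le> (\<Prod>j\<leftarrow>js. f j :: real)"
  by (induction js) auto

lemma prod_list_pos:
  "(\<And>j. j \<in> set js \<Longrightarrow> 0 < f j) \<Longrightarrow> 0 < (\<Prod>j\<leftarrow>js. f j :: real)"
  by (induction js) auto

lemma prod_list_mono:
  "(\<And>j. j \<in> set js \<Longrightarrow> 0 \<le> f j \<and> f j \<le> g j) \<Longrightarrow> (\<Prod>j\<leftarrow>js. f j :: real) \<le> (\<Prod>j\<leftarrow>js. g j)"
proof (induction js)
  case (Cons a js)
  then have "0 \<le> (\<Prod>j\<leftarrow>js. f j)"
    by (intro prod_list_nonneg) auto
  with Cons show ?case
    by (fastforce intro!: mult_mono)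
qed simp

lemma prod_list_scale:
  "(\<Prod>j\<leftarrow>js. t * f j :: real) = t ^ length js * (\<Prod>j\<leftarrow>js. f j)"
  by (induction js) auto

lemma continuous_on_prod_list:
  fixes f :: "'i \<Rightarrow> 'a::topological_space \<Rightarrow> real"
  shows "(\<And>j. continuous_on S (f j)) \<Longrightarrow> continuous_on S (\<lambda>x. \<Prod>j\<leftarrow>js. f j x)"
  by (induction js) (auto intro!: continuous_intros)

lemma real_apply_nonneg:
  assumes "0 < m" "tensor_nonneg m B" "\<And>j. 0 \<le> x $ j"
  shows "0 \<le> real_apply m B x $ i"
  using assms by (auto simp: real_apply_def tensor_nonneg_def intro!: sum_nonneg mult_nonneg_nonneg prod_list_nonneg)

lemma real_apply_mono:
  assumes "0 < m" "tensor_nonneg m B" "\<And>j. 0 \<le> x $ j" "\<And>j. x $ j \<le> y $ j"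
  shows "real_apply m B x $ i \<le> real_apply m B y $ i"
  using assms by (auto simp: real_apply_def tensor_nonneg_def intro!: sum_mono mult_left_mono prod_list_mono)

lemma real_apply_scaleR:
  "real_apply m B (t *\<^sub>R x) $ i = t ^ (m - 1) * real_apply m B x $ i"
  by (auto simp: real_apply_def prod_list_scale sum_distrib_left intro!: sum.cong)

lemma continuous_on_real_apply:
  "continuous_on S (\<lambda>x. real_apply m B x $ i)"
  unfolding real_apply_def
  by (auto intro!: continuous_intros continuous_on_prod_list)

lemma tensor_apply_vec_of_real:
  "tensor_apply m B (vec_of_real x) = vec_of_real (real_apply m B x)"
  by (simp add: tensor_apply_def real_apply_def vec_of_real_def vec_eq_iff of_real_prod_list)

text \<open>The triangle inequality, with the nonnegative entries passing through the modulus; it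
  brings complex eigenvectors within reach of the monotone real map.\<close>

lemma norm_tensor_apply_le:
  assumes "0 < m" "tensor_nonneg m B"
  shows "cmod (tensor_apply m B z $ i) \<le> real_apply m B (\<chi> j. cmod (z $ j)) $ i"
  using assms
  by (auto simp: tensor_apply_def real_apply_def tensor_nonneg_def norm_mult norm_prod_list
      intro!: sum_norm_le)

lemma eigenpair_vec_of_real_iff:
  "tensor_eigenpair m B (of_real r) (vec_of_real x) \<longleftrightarrow>
     x \<noteq> 0 \<and> (\<forall>i. real_apply m B x $ i = r * (x $ i) ^ (m - 1))"
proof -
  have "complex_of_real a = of_real r * of_real b ^ (m - 1) \<longleftrightarrow> a = r * b ^ (m - 1)" for a b
    by (metis of_real_eq_iff of_real_mult of_real_power)
  then show ?thesis
    unfolding tensor_eigenpair_def tensor_apply_vec_of_real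
    by (auto simp: vec_of_real_def vec_eq_iff)
qed

lemma nonneg_vec_iff: "nonneg_vec z \<longleftrightarrow> (\<exists>x. z = vec_of_real x \<and> (\<forall>i. 0 \<le> x $ i))"
proof
  assume "nonneg_vec z"
  then show "\<exists>x. z = vec_of_real x \<and> (\<forall>i. 0 \<le> x $ i)"
    by (intro exI[of _ "\<chi> i. Re (z $ i)"]) (auto simp: nonneg_vec_def vec_of_real_def vec_eq_iff of_real_Re)
qed (auto simp: nonneg_vec_def vec_of_real_def)

lemma pos_vec_iff: "pos_vec z \<longleftrightarrow> (\<exists>x. z = vec_of_real x \<and> (\<forall>i. 0 < x $ i))"
proof
  assume "pos_vec z"
  then show "\<exists>x. z = vec_of_real x \<and> (\<forall>i. 0 < x $ i)"
    by (intro exI[of _ "\<chi> i. Re (z $ i)"]) (auto simp: pos_vec_def vec_of_real_def vec_eq_iff of_real_Re)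
qed (auto simp: pos_vec_def vec_of_real_def)

section \<open>Comparison with a positive vector\<close>

text \<open>At an index where \<open>|z|\<close> touches the dominating multiple of
  \<open>x\<close>, monotonicity and homogeneity bound \<open>cmod l\<close>. The condition on
  \<open>x\<close> is an inequality so that it covers both a perturbed eigenvector, after dropping
  \<open>e\<close>, and a true positive eigenvector.\<close>

lemma eigenvalue_bound:
  assumes m: "0 < m" and B: "tensor_nonneg m B"
    and x: "\<And>i. 0 < x $ i" "\<And>i. real_apply m B x $ i \<le> r * (x $ i) ^ (m - 1)"
    and l: "tensor_eigenvalue m B l"
  shows "cmod l \<le> r"
proof -
  obtain z where "z \<noteq> 0" and z: "tensor_apply m B z = (\<chi> i. l * (z $ i) ^ (m - 1))"
    using l by (auto simp: tensor_eigenvalue_def tensor_eigenpair_def)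
  then obtain p where p: "z $ p \<noteq> 0"
    by (auto simp: vec_eq_iff)
  \<comment> \<open>The least \<open>t\<close> with \<open>cmod (z $ i) \<le> t * x $ i\<close> for
    all \<open>i\<close> is the largest ratio; as there are finitely many indices, equality holds at
    some \<open>h\<close>.\<close>
  define q where "q i = cmod (z $ i) / x $ i" for i
  define t where "t = Max (range q)"
  have t_ge: "q i \<le> t" for i
    by (simp add: t_def)
  have "t \<in> range q"
    unfolding t_def by (intro Max_in) auto
  then obtain h where h: "t = q h"
    by auto
  have "0 < q p"
    using p x(1)[of p] by (simp add: q_def)
  with t_ge[of p] have t: "0 < t"
    by linarith
  have zx: "cmod (z $ i) \<le> t * x $ i" for i
    using t_ge[of i] x(1)[of i] by (simp add: q_def divide_simps)
  have zh: "cmod (z $ h) = t * x $ h"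
    using x(1)[of h] by (simp add: h q_def)
  \<comment> \<open>Both ends of the chain carry the factor \<open>(t * x $ h) ^ (m - 1)\<close>,
    which is positive and cancels.\<close>
  have "cmod l * (t * x $ h) ^ (m - 1) = cmod (tensor_apply m B z $ h)"
    by (simp add: z norm_mult norm_power zh)
  also have "\<dots> \<le> real_apply m B (\<chi> j. cmod (z $ j)) $ h"
    by (rule norm_tensor_apply_le[OF m B])
  also have "\<dots> \<le> real_apply m B (t *\<^sub>R x) $ h"
    using zx by (intro real_apply_mono[OF m B]) auto
  also have "\<dots> \<le> t ^ (m - 1) * (r * (x $ h) ^ (m - 1))"
    unfolding real_apply_scaleR using t x(2) by (intro mult_left_mono) auto
  also have "\<dots> = r * (t * x $ h) ^ (m - 1)"
    by (simp add: power_mult_distrib)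
  finally show ?thesis
    using t x(1)[of h] by simp
qed

section \<open>The standard simplex and perturbed eigenvectors\<close>

definition std_simplex :: "(real ^ 'n::finite) set" where
  "std_simplex = {x. (\<forall>i. 0 \<le> x $ i) \<and> (\<Sum>i\<in>UNIV. x $ i) = 1}"

lemma convex_std_simplex: "convex std_simplex"
  by (auto simp: std_simplex_def convex_def sum.distrib simp flip: sum_distrib_left)

lemma compact_std_simplex: "compact (std_simplex :: (real ^ 'n::finite) set)"
proof -
  have "norm x \<le> 1" if "x \<in> std_simplex" for x :: "real ^ 'n"
    using norm_le_l1_cart[of x] that by (simp add: std_simplex_def)
  then have "bounded (std_simplex :: (real ^ 'n) set)"
    by (auto simp: bounded_iff)
  moreover have "closed (std_simplex :: (real ^ 'n) set)"
    unfolding std_simplex_def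
    by (intro closed_Collect_conj closed_Collect_all closed_Collect_le closed_Collect_eq)
       (auto intro!: continuous_intros)
  ultimately show ?thesis
    by (simp add: compact_eq_bounded_closed)
qed

lemma std_simplex_nonempty: "(std_simplex :: (real ^ 'n::finite) set) \<noteq> {}"
proof -
  have "(\<chi> i. 1 / real CARD('n)) \<in> (std_simplex :: (real ^ 'n) set)"
    by (simp add: std_simplex_def)
  then show ?thesis
    by blast
qed

lemma std_simplex_nonzero: "x \<in> std_simplex \<Longrightarrow> x \<noteq> 0"
  by (auto simp: std_simplex_def)

text \<open>A fixed point of \<open>T\<close> satisfies \<open>g x i = s * x $ i\<close> with
  \<open>s\<close> the normalising sum; its \<open>(m - 1)\<close>-th power is the claim with
  \<open>r = s ^ (m - 1)\<close>. The summand \<open>e\<close> keeps \<open>g\<close> positive, so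
  the normalisation is defined and the fixed point is positive.\<close>

lemma perturbed_eigenvector:
  assumes m: "2 \<le> m" and B: "tensor_nonneg m (B :: 'n::finite tensor)" and e: "0 < e"
  obtains x r where "x \<in> std_simplex" "\<And>i. 0 < x $ i"
    "\<And>i. real_apply m B x $ i + e = r * (x $ i) ^ (m - 1)"
proof -
  define g where "g x i = root (m - 1) (real_apply m B x $ i + e)" for x i
  define T where "T x = (\<chi> i. g x i / (\<Sum>j\<in>UNIV. g x j))" for x
  \<comment> \<open>\<open>root 0\<close> is constantly 0, so \<open>2 \<le> m\<close> matters
    here.\<close>
  have g_pos: "0 < g x i" if "x \<in> std_simplex" for x i
  proof -
    have "0 \<le> real_apply m B x $ i"
      using m B that by (intro real_apply_nonneg) (auto simp: std_simplex_def)
    then show ?thesis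
      using e m by (simp add: g_def real_root_gt_zero)
  qed
  have s_pos: "0 < (\<Sum>j\<in>UNIV. g x j)" if "x \<in> std_simplex" for x
    using g_pos[OF that] by (intro sum_pos) auto
  have "continuous_on std_simplex (\<lambda>x. g x i)" for i
    unfolding g_def by (intro continuous_intros continuous_on_real_apply)
  then have "continuous_on std_simplex T"
    unfolding T_def using s_pos by (intro continuous_intros) (auto simp: less_le)
  moreover have "T \<in> std_simplex \<rightarrow> std_simplex"
  proof
    fix x :: "real ^ 'n"
    assume x: "x \<in> std_simplex"
    have "(\<Sum>i\<in>UNIV. T x $ i) = 1"
      using s_pos[OF x] by (simp add: T_def flip: sum_divide_distrib)
    then show "T x \<in> std_simplex"
      using g_pos[OF x] s_pos[OF x] by (auto simp: std_simplex_def T_def less_imp_le)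
  qed
  ultimately obtain x where x: "x \<in> std_simplex" "T x = x"
    using brouwer[OF compact_std_simplex convex_std_simplex std_simplex_nonempty] by blast
  define s where "s = (\<Sum>j\<in>UNIV. g x j)"
  have s: "0 < s"
    using s_pos[OF x(1)] by (simp add: s_def)
  have gx: "g x i = s * x $ i" for i
    using arg_cong[OF x(2), of "\<lambda>v. v $ i"] s by (simp add: T_def s_def[symmetric] field_simps)
  show ?thesis
  proof (rule that[OF x(1)])
    show "0 < x $ i" for i
      using g_pos[OF x(1), of i] s by (simp add: gx zero_less_mult_iff)
    have "0 \<le> real_apply m B x $ i" for i
      using m B x(1) by (intro real_apply_nonneg) (auto simp: std_simplex_def)
    then have "real_apply m B x $ i + e = g x i ^ (m - 1)" for i
      using m e by (simp add: g_def real_root_pow_pos2 add_nonneg_nonneg)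
    then show "real_apply m B x $ i + e = s ^ (m - 1) * (x $ i) ^ (m - 1)" for i
      by (simp add: gx power_mult_distrib)
  qed
qed

section \<open>Passage to the limit and the spectral radius\<close>

text \<open>Every perturbed value \<open>R k\<close> bounds all eigenvalues of \<open>B\<close> in
  modulus, and this survives the limit. The simplex is compact and misses 0, so the limit vector is
  still an eigenvector.\<close>

lemma dominant_eigenpair:
  assumes m: "2 \<le> m" and B: "tensor_nonneg m (B :: 'n::finite tensor)"
  obtains x r where "x \<in> std_simplex" "0 \<le> r"
    "tensor_eigenpair m B (of_real r) (vec_of_real x)"
    "\<forall>l. tensor_eigenvalue m B l \<longrightarrow> cmod l \<le> r"
proof -
  have "\<forall>k. \<exists>x r. x \<in> std_simplex \<and> (\<forall>i. 0 < x $ i) \<and>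
      (\<forall>i. real_apply m B x $ i + inverse (real (Suc k)) = r * (x $ i) ^ (m - 1))"
  proof
    show "\<exists>x r. x \<in> std_simplex \<and> (\<forall>i. 0 < x $ i) \<and>
        (\<forall>i. real_apply m B x $ i + inverse (real (Suc k)) = r * (x $ i) ^ (m - 1))" for k
      by (rule perturbed_eigenvector[OF m B, of "inverse (real (Suc k))"]) auto
  qed
  then have "\<exists>X R. \<forall>k. X k \<in> std_simplex \<and> (\<forall>i. 0 < X k $ i) \<and>
      (\<forall>i. real_apply m B (X k) $ i + inverse (real (Suc k)) = R k * (X k $ i) ^ (m - 1))"
    by (simp only: choice_iff)
  then obtain X R where X: "\<And>k. X k \<in> std_simplex" "\<And>k i. 0 < X k $ i"
    and XR: "\<And>k i. real_apply m B (X k) $ i + inverse (real (Suc k)) = R k * (X k $ i) ^ (m - 1)"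
    by blast
  obtain x s where x: "x \<in> std_simplex" and s: "strict_mono s" and lim: "(X \<circ> s) \<longlonglongrightarrow> x"
    using seq_compactE[OF compact_imp_seq_compact[OF compact_std_simplex], of X] X(1) by blast
  have lim_i: "(\<lambda>k. X (s k) $ i) \<longlonglongrightarrow> x $ i" for i
    using tendsto_vec_nth[OF lim] by (simp add: o_def)
  have "(\<lambda>k. inverse (real (Suc (s k)))) \<longlonglongrightarrow> 0"
    using LIMSEQ_subseq_LIMSEQ[OF LIMSEQ_inverse_real_of_nat s] by (simp add: o_def)
  moreover have "(\<lambda>k. real_apply m B (X (s k)) $ i) \<longlonglongrightarrow> real_apply m B x $ i" for i
    using continuous_on_tendsto_compose[OF continuous_on_real_apply[of UNIV m B i] lim]
    by (simp add: o_def)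
  ultimately have lhs:
    "(\<lambda>k. real_apply m B (X (s k)) $ i + inverse (real (Suc (s k)))) \<longlonglongrightarrow> real_apply m B x $ i" for i
    using tendsto_add by fastforce
  \<comment> \<open>Compactness controls \<open>X\<close> but not \<open>R\<close>. At an index
    where the limit vector is nonzero, the perturbed equation can be solved for
    \<open>R (s k)\<close>, a quotient of convergent sequences.\<close>
  obtain h where h: "x $ h \<noteq> 0"
    using std_simplex_nonzero[OF x] by (auto simp: vec_eq_iff)
  define r where "r = real_apply m B x $ h / (x $ h) ^ (m - 1)"
  have R: "(\<lambda>k. R (s k)) \<longlonglongrightarrow> r"
  proof -
    have eq: "(real_apply m B (X (s k)) $ h + inverse (real (Suc (s k)))) / (X (s k) $ h) ^ (m - 1)
        = R (s k)" for k
      using X(2)[of "s k" h] unfolding XR by simp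
    have "(\<lambda>k. (real_apply m B (X (s k)) $ h + inverse (real (Suc (s k)))) / (X (s k) $ h) ^ (m - 1))
        \<longlonglongrightarrow> r"
      unfolding r_def using h by (intro tendsto_divide tendsto_power lhs lim_i) simp
    then show ?thesis
      unfolding eq .
  qed
  have "(\<lambda>k. R (s k) * (X (s k) $ i) ^ (m - 1)) \<longlonglongrightarrow> r * (x $ i) ^ (m - 1)" for i
    by (intro tendsto_intros R lim_i)
  then have "real_apply m B x $ i = r * (x $ i) ^ (m - 1)" for i
    using LIMSEQ_unique[OF lhs[of i, unfolded XR]] by blast
  then have pair: "tensor_eigenpair m B (of_real r) (vec_of_real x)"
    using std_simplex_nonzero[OF x] by (simp add: eigenpair_vec_of_real_iff)
  have bound: "cmod l \<le> r" if l: "tensor_eigenvalue m B l" for l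
  proof (rule LIMSEQ_le_const[OF R])
    have "cmod l \<le> R k" for k
    proof (rule eigenvalue_bound[OF _ B X(2)[of k] _ l])
      show "real_apply m B (X k) $ i \<le> R k * (X k $ i) ^ (m - 1)" for i
        unfolding XR[symmetric] by simp
    qed (use m in simp)
    then show "\<exists>N. \<forall>k\<ge>N. cmod l \<le> R (s k)"
      by blast
  qed
  \<comment> \<open>The bound applied to the eigenvalue \<open>r\<close> itself forces
    \<open>r\<close> to be nonnegative.\<close>
  have "cmod (of_real r) \<le> r"
    using pair by (intro bound) (auto simp: tensor_eigenvalue_def)
  then have "0 \<le> r"
    by simp
  then show ?thesis
    using that x pair bound by blast
qed

text \<open>The dominant eigenvalue is nonnegative, hence its own modulus; so the maximum behind
  \<open>GREATEST\<close> is attained there.\<close>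

lemma spectral_radius_eigenpair_bound:
  assumes "2 \<le> m" "tensor_nonneg m B"
  obtains x where "\<forall>i. 0 \<le> x $ i"
    "tensor_eigenpair m B (of_real (tensor_spectral_radius m B)) (vec_of_real x)"
    "\<forall>l. tensor_eigenvalue m B l \<longrightarrow> cmod l \<le> tensor_spectral_radius m B"
proof -
  obtain x r where x: "x \<in> std_simplex" and r: "0 \<le> r"
    and pair: "tensor_eigenpair m B (of_real r) (vec_of_real x)"
    and bound: "\<forall>l. tensor_eigenvalue m B l \<longrightarrow> cmod l \<le> r"
    using dominant_eigenpair[OF assms] by blast
  have "tensor_spectral_radius m B = r"
    unfolding tensor_spectral_radius_def
  proof (rule Greatest_equality)
    show "\<exists>l. tensor_eigenvalue m B l \<and> r = cmod l"
      using r pair by (intro exI[of _ "of_real r"]) (auto simp: tensor_eigenvalue_def)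
  qed (use bound in auto)
  with x pair bound that show ?thesis
    by (auto simp: std_simplex_def)
qed

lemma spectral_radius_eigenpair:
  assumes "2 \<le> m" "tensor_nonneg m B"
  obtains x where "\<And>i. 0 \<le> x $ i"
    "tensor_eigenpair m B (of_real (tensor_spectral_radius m B)) (vec_of_real x)"
  using spectral_radius_eigenpair_bound[OF assms] by metis

lemma eigenvalue_le_spectral_radius:
  assumes "2 \<le> m" "tensor_nonneg m B" "tensor_eigenvalue m B l"
  shows "cmod l \<le> tensor_spectral_radius m B"
  using spectral_radius_eigenpair_bound[OF assms(1,2)] assms(3) by metis

text \<open>Comparison with the positive eigenvector bounds the spectral radius by its eigenvalue,
  and no eigenvalue exceeds the spectral radius in modulus.\<close>

lemma positive_eigenvector_spectral_radius:
  assumes m: "2 \<le> m" and B: "tensor_nonneg m (B :: 'n::finite tensor)"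
    and x: "tensor_eigenpair m B l x" "pos_vec x"
  shows "l = of_real (tensor_spectral_radius m B)"
proof -
  obtain y where y: "x = vec_of_real y" "\<And>i. 0 < y $ i"
    using x(2) by (auto simp: pos_vec_iff)
  \<comment> \<open>Any index serves: as \<open>y $ h\<close> is positive, the equation at
    \<open>h\<close> shows that \<open>l\<close> is real.\<close>
  fix h :: 'n
  define r where "r = real_apply m B y $ h / (y $ h) ^ (m - 1)"
  have "tensor_apply m B x $ h = l * (x $ h) ^ (m - 1)"
    using x(1) by (simp add: tensor_eigenpair_def)
  then have "of_real (real_apply m B y $ h) = l * of_real (y $ h) ^ (m - 1)"
    by (simp add: y(1) tensor_apply_vec_of_real) (simp add: vec_of_real_def)
  then have l: "l = of_real r"
    using y(2)[of h] by (simp add: r_def field_simps)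
  have eq: "real_apply m B y $ i = r * (y $ i) ^ (m - 1)" for i
    using x(1) by (simp add: l y(1) eigenpair_vec_of_real_iff)
  obtain z where "tensor_eigenpair m B (of_real (tensor_spectral_radius m B)) (vec_of_real z)"
    using spectral_radius_eigenpair[OF m B] by blast
  then have "cmod (of_real (tensor_spectral_radius m B)) \<le> r"
    using m y(2) eq B
    by (intro eigenvalue_bound[of m B y]) (auto simp: tensor_eigenvalue_def)
  moreover have "cmod l \<le> tensor_spectral_radius m B"
    using x(1) by (intro eigenvalue_le_spectral_radius[OF m B]) (auto simp: tensor_eigenvalue_def)
  ultimately show ?thesis
    using l by simp
qed

section \<open>Positivity under irreducibility\<close>

text \<open>Otherwise the zero set \<open>I\<close> of \<open>x\<close> reduces \<open>B\<close>: at
  an index of \<open>I\<close> a sum of nonnegative terms vanishes, so each term does, and for lists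
  avoiding \<open>I\<close> the product of components is positive, so the entry is 0.\<close>

lemma irreducible_eigenvector_pos:
  assumes m: "2 \<le> m" and B: "tensor_nonneg m B" and irr: "\<not> tensor_reducible m B"
    and x: "\<And>i. 0 \<le> x $ i" "tensor_eigenpair m B (of_real r) (vec_of_real x)"
  shows "0 < x $ i"
proof (rule ccontr)
  assume "\<not> 0 < x $ i"
  define I where "I = {i. x $ i = 0}"
  have "x $ i = 0"
    using \<open>\<not> 0 < x $ i\<close> x(1)[of i] by simp
  then have "I \<noteq> {}"
    by (auto simp: I_def)
  moreover have "I \<noteq> UNIV"
    using x(2) by (auto simp: I_def eigenpair_vec_of_real_iff vec_eq_iff)
  moreover have "B (p # js) = 0" if p: "p \<in> I" and js: "length js = m - 1" "set js \<inter> I = {}" for p js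
  proof -
    \<comment> \<open>As \<open>m - 1\<close> is positive, \<open>r * 0 ^ (m - 1)\<close>
      vanishes.\<close>
    have "real_apply m B x $ p = 0"
      using x(2) m p by (auto simp: eigenpair_vec_of_real_iff I_def)
    moreover have "0 \<le> B (p # ks) * (\<Prod>j\<leftarrow>ks. x $ j)" if "length ks = m - 1" for ks
      using that B m x(1) by (auto simp: tensor_nonneg_def intro!: mult_nonneg_nonneg prod_list_nonneg)
    ultimately have "B (p # js) * (\<Prod>j\<leftarrow>js. x $ j) = 0"
      using js(1) sum_nonneg_eq_0_iff[OF finite_lists_length[of "m - 1"],
          of "\<lambda>js. B (p # js) * (\<Prod>j\<leftarrow>js. x $ j)"]
      by (simp add: real_apply_def)
    moreover have "0 < (\<Prod>j\<leftarrow>js. x $ j)"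
      using js(2) x(1) by (intro prod_list_pos) (auto simp: I_def less_le)
    ultimately show ?thesis
      by simp
  qed
  ultimately show False
    using irr unfolding tensor_reducible_def by blast
qed

section \<open>Passing from \<open>B\<close> to \<open>A\<close>\<close>

lemma tensor_apply_unit:
  "tensor_apply m unit_tensor x = (\<chi> i. (x $ i) ^ (m - 1))"
proof -
  have "(\<Sum>js\<in>{js. length js = m - 1}. of_real (unit_tensor (i # js)) * (\<Prod>j\<leftarrow>js. x $ j))
      = (\<Sum>js\<in>{replicate (m - 1) i}. \<Prod>j\<leftarrow>js. x $ j)" for i
  proof (rule sum.mono_neutral_cong_right[OF finite_lists_length])
    show "\<forall>js\<in>{js. length js = m - 1} - {replicate (m - 1) i}.
        of_real (unit_tensor (i # js)) * (\<Prod>j\<leftarrow>js. x $ j) = 0"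
      by (auto simp: unit_tensor_def list_eq_iff_nth_eq)
  qed (auto simp: unit_tensor_def)
  then show ?thesis
    by (simp add: tensor_apply_def map_replicate prod_list_replicate)
qed

text \<open>The action is linear in the tensor and the unit tensor acts as the componentwise power,
  so eigenvectors are shared.\<close>

lemma eigenpair_shift:
  fixes A B :: "'n::finite tensor"
  assumes m: "0 < m" and A: "\<And>js. length js = m \<Longrightarrow> A js = c * unit_tensor js - B js"
  shows "tensor_eigenpair m A l x \<longleftrightarrow> tensor_eigenpair m B (of_real c - l) x"
proof -
  have "tensor_apply m A x $ i = of_real c * tensor_apply m unit_tensor x $ i - tensor_apply m B x $ i" for i
    using m by (auto simp: tensor_apply_def A sum_distrib_left algebra_simps
        simp flip: sum_subtractf intro!: sum.cong)
  then have "tensor_apply m A x $ i = of_real c * (x $ i) ^ (m - 1) - tensor_apply m B x $ i" for i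
    by (simp add: tensor_apply_unit)
  then have "tensor_apply m A x $ i = l * (x $ i) ^ (m - 1) \<longleftrightarrow>
      tensor_apply m B x $ i = (of_real c - l) * (x $ i) ^ (m - 1)" for i
    unfolding left_diff_distrib by (metis add_diff_cancel_left' diff_diff_eq2 add_diff_cancel_right')
  then show ?thesis
    unfolding tensor_eigenpair_def vec_eq_iff by simp
qed

text \<open>Reducibility looks only at non-constant index lists, where the unit tensor is 0. It is
  applied contrapositively: irreducibility of \<open>A\<close> passes to \<open>B\<close>.\<close>

lemma reducible_shift:
  fixes A B :: "'n::finite tensor"
  assumes m: "2 \<le> m" and A: "\<And>js. length js = m \<Longrightarrow> A js = c * unit_tensor js - B js"
    and B: "tensor_reducible m B"
  shows "tensor_reducible m A"
proof -
  obtain I where I: "I \<noteq> {}" "I \<noteq> UNIV"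
    "\<And>i js. i \<in> I \<Longrightarrow> length js = m - 1 \<Longrightarrow> set js \<inter> I = {} \<Longrightarrow> B (i # js) = 0"
    using B unfolding tensor_reducible_def by blast
  have "A (i # js) = 0" if "i \<in> I" "length js = m - 1" "set js \<inter> I = {}" for i js
  proof -
    \<comment> \<open>A nonempty \<open>js\<close> contains some \<open>j\<close> outside
      \<open>I\<close>, hence different from \<open>i\<close>; the list \<open>[i]\<close> alone
      would be constant.\<close>
    have "js \<noteq> []"
      using that(2) m by auto
    then obtain j where "j \<in> set js"
      by (meson list.set_sel(1))
    then have "unit_tensor (i # js) = 0"
      using that by (auto simp: unit_tensor_def)
    then show ?thesis
      using that m I(3) by (simp add: A)
  qed
  with I(1,2) show ?thesis
    unfolding tensor_reducible_def by blast
qed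

text \<open>An eigenvalue \<open>l\<close> of \<open>A\<close> has
  \<open>cmod (of_real c - l)\<close> at most the spectral radius of \<open>B\<close>, which bounds
  \<open>Re l\<close> below; the Perron eigenvalue of \<open>B\<close> attains the bound, so
  \<open>LEAST\<close> is determined.\<close>

lemma tau_shift:
  assumes m: "2 \<le> m" and B: "tensor_nonneg m B"
    and A: "\<And>js. length js = m \<Longrightarrow> A js = c * unit_tensor js - B js"
  shows "tensor_tau m A = c - tensor_spectral_radius m B"
proof -
  have ev: "tensor_eigenvalue m A l \<longleftrightarrow> tensor_eigenvalue m B (of_real c - l)" for l
    using m A by (simp add: tensor_eigenvalue_def eigenpair_shift[of m A c B])
  obtain x where "tensor_eigenpair m B (of_real (tensor_spectral_radius m B)) (vec_of_real x)"
    using spectral_radius_eigenpair[OF m B] by blast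
  then have "tensor_eigenvalue m A (of_real (c - tensor_spectral_radius m B))"
    unfolding ev by (auto simp: tensor_eigenvalue_def)
  moreover have "c - tensor_spectral_radius m B \<le> Re l" if "tensor_eigenvalue m A l" for l
    using eigenvalue_le_spectral_radius[OF m B, of "of_real c - l"] that
      complex_Re_le_cmod[of "of_real c - l"] by (simp add: ev)
  ultimately show ?thesis
    unfolding tensor_tau_def by (intro Least_equality) (auto intro: Re_complex_of_real[symmetric])
qed

theorem theorem3p1:
  fixes A :: "'n::finite tensor" and m :: nat
  assumes "2 \<le> m"
    and "M_tensor m A"
  shows "0 < tensor_tau m A
    \<and> (\<exists>x. tensor_eigenpair m A (of_real (tensor_tau m A)) x \<and> nonneg_vec x)
    \<and> (\<exists>(B :: 'n tensor) (c :: real). tensor_nonneg m B \<and> tensor_spectral_radius m B < c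
         \<and> tensor_tau m A = c - tensor_spectral_radius m B)
    \<and> (\<not> tensor_reducible m A \<longrightarrow>
         (\<exists>x. tensor_eigenpair m A (of_real (tensor_tau m A)) x \<and> pos_vec x)
         \<and> (\<forall>l x. tensor_eigenpair m A l x \<and> pos_vec x \<longrightarrow> l = of_real (tensor_tau m A)))"
proof -
  \<comment> \<open>This pair also witnesses the third claim.\<close>
  obtain B c where B: "tensor_nonneg m B" and c: "tensor_spectral_radius m B < c"
    and A: "\<And>js. length js = m \<Longrightarrow> A js = c * unit_tensor js - B js"
    using assms(2) unfolding M_tensor_def by blast
  have tau: "tensor_tau m A = c - tensor_spectral_radius m B"
    by (rule tau_shift[OF assms(1) B A])
  have shift: "tensor_eigenpair m A l x \<longleftrightarrow> tensor_eigenpair m B (of_real c - l) x" for l x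
    using assms(1) A by (intro eigenpair_shift) auto
  \<comment> \<open>One vector serves twice: as the nonnegative eigenvector and, if \<open>A\<close>
    is irreducible, as the positive one.\<close>
  obtain x where x: "\<And>i. 0 \<le> x $ i"
    "tensor_eigenpair m B (of_real (tensor_spectral_radius m B)) (vec_of_real x)"
    using spectral_radius_eigenpair[OF assms(1) B] by blast
  have pair: "tensor_eigenpair m A (of_real (tensor_tau m A)) (vec_of_real x)"
    using x(2) by (simp add: shift tau)
  moreover have "nonneg_vec (vec_of_real x)"
    using x(1) by (auto simp: nonneg_vec_iff)
  moreover have "pos_vec (vec_of_real x)" if "\<not> tensor_reducible m A"
  proof -
    have "\<not> tensor_reducible m B"
      using that reducible_shift[OF assms(1) A] by blast
    then have "0 < x $ i" for i
      using irreducible_eigenvector_pos[OF assms(1) B _ x] by blast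
    then show ?thesis
      by (auto simp: pos_vec_iff)
  qed
  moreover have "l = of_real (tensor_tau m A)" if "tensor_eigenpair m A l y" "pos_vec y" for l y
  proof -
    have "of_real c - l = of_real (tensor_spectral_radius m B)"
      using that by (intro positive_eigenvector_spectral_radius[OF assms(1) B]) (auto simp: shift)
    then show ?thesis
      by (simp add: tau algebra_simps)
  qed
  moreover have "0 < tensor_tau m A"
    using c tau by simp
  ultimately show ?thesis
    using B c tau by blast
qed

end
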